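(* The infinite-rank plactic monoid $\mathsf{plac}$ does not satisfy any non-trivial identity.
   Context: An identity is a formal equality $u = v$ between two words $u,v$ in a free monoid over a set of variables; it is non-trivial if $u \neq v$ as words. A monoid $M$ satisfies the identity if the equality holds in $M$ under every substitution of the variables by elements of $M$. Let $\mathcal{A} = \{1 < 2 < 3 < \dots\}$ be the natural numbers viewed as an infinite ordered alphabet. The plactic monoid $\mathsf{plac}$ is the quotient of the free monoid $\mathcal{A}^*$ by the plactic (Knuth) congruence, i.e. the congruence generated by the relations $zxy = xzy$ for letters $x \le y < z$ and $yxz = yzx$ for letters $x < y \le z$ (equivalently, words are congruent iff Schensted's algorithm yields the same Young tableau). *)

theory Defs
  imports "HOL-Algebra.Group"
begin

definition word_eval :: "('a, 'm) monoid_scheme \<Rightarrow> ('x \<Rightarrow> 'a) \<Rightarrow> 'x list \<Rightarrow> 'a" where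
  "word_eval M \<sigma> w = foldr (mult M) (map \<sigma> w) \<one>\<^bsub>M\<^esub>"

definition satisfies_identity :: "('a, 'm) monoid_scheme \<Rightarrow> 'x list \<Rightarrow> 'x list \<Rightarrow> bool" where
  "satisfies_identity M u v \<longleftrightarrow>
     (\<forall>\<sigma>. range \<sigma> \<subseteq> carrier M \<longrightarrow> word_eval M \<sigma> u = word_eval M \<sigma> v)"

definition alphabet :: "nat set" where
  "alphabet = {1..}"

inductive_set plactic_cong :: "(nat list \<times> nat list) set" where
  knuth1: "\<lbrakk>x \<in> alphabet; y \<in> alphabet; z \<in> alphabet; x \<le> y; y < z\<rbrakk>
             \<Longrightarrow> ([z, x, y], [x, z, y]) \<in> plactic_cong"
| knuth2: "\<lbrakk>x \<in> alphabet; y \<in> alphabet; z \<in> alphabet; x < y; y \<le> z\<rbrakk>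
             \<Longrightarrow> ([y, x, z], [y, z, x]) \<in> plactic_cong"
| refl: "w \<in> lists alphabet \<Longrightarrow> (w, w) \<in> plactic_cong"
| sym: "(u, v) \<in> plactic_cong \<Longrightarrow> (v, u) \<in> plactic_cong"
| trans: "\<lbrakk>(u, v) \<in> plactic_cong; (v, w) \<in> plactic_cong\<rbrakk> \<Longrightarrow> (u, w) \<in> plactic_cong"
| append: "\<lbrakk>(u, v) \<in> plactic_cong; (u', v') \<in> plactic_cong\<rbrakk>
             \<Longrightarrow> (u @ u', v @ v') \<in> plactic_cong"

definition plac :: "nat list set monoid" where
  "plac = \<lparr>carrier = lists alphabet // plactic_cong,
           mult = (\<lambda>A B. \<Union>u\<in>A. \<Union>v\<in>B. plactic_cong `` {u @ v}),
           one = plactic_cong `` {[]}\<rparr>"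

lemma plactic_cong_in_lists:
  "(u, v) \<in> plactic_cong \<Longrightarrow> u \<in> lists alphabet \<and> v \<in> lists alphabet"
  by (induction rule: plactic_cong.induct) auto

lemma equiv_plactic_cong: "equiv (lists alphabet) plactic_cong"
proof (rule equivI)
  show "plactic_cong \<subseteq> lists alphabet \<times> lists alphabet"
    by (rule subrelI) (simp only: plactic_cong_in_lists mem_Sigma_iff simp_thms)
  show "refl_on (lists alphabet) plactic_cong"
    by (rule refl_onI) (rule plactic_cong.refl)
  show "sym plactic_cong"
    by (rule symI) (rule plactic_cong.sym)
  show "trans plactic_cong"
    by (rule transI) (rule plactic_cong.trans)
qed

lemma plac_mult_class:
  assumes "u \<in> lists alphabet" "v \<in> lists alphabet"
  shows "plactic_cong `` {u} \<otimes>\<^bsub>plac\<^esub> plactic_cong `` {v} = plactic_cong `` {u @ v}"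
proof -
  have eq: "plactic_cong `` {u' @ v'} = plactic_cong `` {u @ v}"
    if "u' \<in> plactic_cong `` {u}" "v' \<in> plactic_cong `` {v}" for u' v'
  proof -
    have "(u @ v, u' @ v') \<in> plactic_cong"
      using that by (blast intro: plactic_cong.append)
    then show ?thesis
      by (rule equiv_class_eq[OF equiv_plactic_cong, symmetric])
  qed
  have u: "u \<in> plactic_cong `` {u}" and v: "v \<in> plactic_cong `` {v}"
    using assms by (blast intro: plactic_cong.refl)+
  have "plactic_cong `` {u} \<otimes>\<^bsub>plac\<^esub> plactic_cong `` {v}
      = (\<Union>u'\<in>plactic_cong `` {u}. \<Union>v'\<in>plactic_cong `` {v}. plactic_cong `` {u' @ v'})"
    by (simp only: plac_def monoid.simps)
  also have "\<dots> = (\<Union>u'\<in>plactic_cong `` {u}. \<Union>v'\<in>plactic_cong `` {v}. plactic_cong `` {u @ v})"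
    by (intro SUP_cong HOL.refl eq)
  also have "\<dots> = plactic_cong `` {u @ v}"
    using u v by fast
  finally show ?thesis .
qed

lemma monoid_plac: "monoid plac"
proof -
  have in_carrier: "plactic_cong `` {w} \<in> carrier plac" if "w \<in> lists alphabet" for w
    using that by (simp add: plac_def quotientI)
  have rep: thesis
    if "A \<in> carrier plac"
      and "\<And>w. \<lbrakk>w \<in> lists alphabet; A = plactic_cong `` {w}\<rbrakk> \<Longrightarrow> thesis" for A thesis
    using that(1) by (auto simp: plac_def elim!: quotientE intro: that(2))
  have one: "\<one>\<^bsub>plac\<^esub> = plactic_cong `` {[]}"
    by (simp add: plac_def)
  have nil: "[] \<in> lists alphabet"
    by (rule lists.Nil)
  have app: "u @ v \<in> lists alphabet" if "u \<in> lists alphabet" "v \<in> lists alphabet" for u v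
    using that by (simp only: append_in_lists_conv)
  show ?thesis
  proof
    fix A B assume "A \<in> carrier plac" "B \<in> carrier plac"
    then obtain u v where "u \<in> lists alphabet" "A = plactic_cong `` {u}"
      and "v \<in> lists alphabet" "B = plactic_cong `` {v}"
      by (elim rep)
    then show "A \<otimes>\<^bsub>plac\<^esub> B \<in> carrier plac"
      by (simp only: plac_mult_class in_carrier app)
  next
    fix A B C assume "A \<in> carrier plac" "B \<in> carrier plac" "C \<in> carrier plac"
    then obtain u v w where "u \<in> lists alphabet" "A = plactic_cong `` {u}"
      and "v \<in> lists alphabet" "B = plactic_cong `` {v}"
      and "w \<in> lists alphabet" "C = plactic_cong `` {w}"
      by (elim rep)
    then show "A \<otimes>\<^bsub>plac\<^esub> B \<otimes>\<^bsub>plac\<^esub> C = A \<otimes>\<^bsub>plac\<^esub> (B \<otimes>\<^bsub>plac\<^esub> C)"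
      by (simp only: plac_mult_class app append_assoc)
  next
    show "\<one>\<^bsub>plac\<^esub> \<in> carrier plac"
      by (simp only: one in_carrier nil)
  next
    fix A assume "A \<in> carrier plac"
    then obtain u where "u \<in> lists alphabet" "A = plactic_cong `` {u}"
      by (elim rep)
    then show "\<one>\<^bsub>plac\<^esub> \<otimes>\<^bsub>plac\<^esub> A = A"
      by (simp only: one plac_mult_class nil append_Nil)
  next
    fix A assume "A \<in> carrier plac"
    then obtain u where "u \<in> lists alphabet" "A = plactic_cong `` {u}"
      by (elim rep)
    then show "A \<otimes>\<^bsub>plac\<^esub> \<one>\<^bsub>plac\<^esub> = A"
      by (simp only: one plac_mult_class nil append_Nil2)
  qed
qed

end

theory Submission
  imports Defs "HOL-Library.Sublist"
begin

text \<open>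
  Congruent words have the same scattered subwords among the descending runs $b, b-1, \dots, a$.
  Suppose $|v| \le |u| = n$ and number the positions of $u$ by $n, n-1, \dots, 1$. Substitute for
  each variable the increasing word of the numbers of the positions it occupies in $u$. The image of
  $u$ contains the run $n, \dots, 1$. Each variable of $v$ can contribute at most one letter to
  this run, so if the image of $v$ contains it too, then $|v| = n$ and the $i$-th variable of $v$ is
  the $i$-th variable of $u$.
\<close>

abbreviation descending_run :: "nat list \<Rightarrow> bool" where
  "descending_run \<equiv> successively (\<lambda>p q. p = Suc q)"

text \<open>Neither side of a Knuth relation is a run of length three, so only runs of length at
  most two need to be compared there. Listing them explicitly leaves arithmetic on the
  letters.\<close>

lemma descending_run_subseq_triple:
  assumes "descending_run r" "\<not> (b = Suc c \<and> a = Suc b)"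
  shows "subseq r [a, b, c] \<longleftrightarrow>
           r \<in> {[], [a], [b], [c]} \<or> r = [a, b] \<and> a = Suc b
           \<or> r = [a, c] \<and> a = Suc c \<or> r = [b, c] \<and> b = Suc c"
proof -
  have "subseq r [a, b, c] \<longleftrightarrow> r \<in> set (subseqs [a, b, c])"
    by (rule in_set_subseqs [symmetric])
  also have "\<dots> \<longleftrightarrow> r \<in> {[], [a], [b], [c], [a, b], [a, c], [b, c], [a, b, c]}"
    by (simp add: Let_def insert_commute del: in_set_subseqs)
  finally show ?thesis
    using assms by (elim ssubst) (safe; simp)
qed

lemma plactic_cong_subseq_descending_run:
  assumes "(u, v) \<in> plactic_cong" "descending_run r"
  shows "subseq r u \<longleftrightarrow> subseq r v"
  using assms
proof (induction arbitrary: r rule: plactic_cong.induct)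
  case (knuth1 x y z)
  then have nrun: "\<not> (x = Suc y \<and> z = Suc x)" "\<not> (z = Suc y \<and> x = Suc z)"
    by simp_all
  \<comment> \<open>Only \<open>x\<close> and \<open>z\<close> change their order. If
    \<open>z = Suc x\<close>, then \<open>x \<le> y < z\<close> forces \<open>y = x\<close>, so the
    run \<open>[z, x]\<close> survives in \<open>[x, z, y]\<close> as \<open>[z, y]\<close>.\<close>
  then show ?case
    unfolding nrun [THEN descending_run_subseq_triple [OF knuth1.prems]] using knuth1.hyps by auto
next
  case (knuth2 x y z)
  then have nrun: "\<not> (x = Suc z \<and> y = Suc x)" "\<not> (z = Suc x \<and> y = Suc z)"
    by simp_all
  \<comment> \<open>Here \<open>z = Suc x\<close> forces \<open>y = z\<close>, so the run
    \<open>[z, x]\<close> occurs in \<open>[y, x, z]\<close> as \<open>[y, x]\<close>.\<close>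
  then show ?case
    unfolding nrun [THEN descending_run_subseq_triple [OF knuth2.prems]] using knuth2.hyps by auto
next
  case (append u v u' v')
  \<comment> \<open>Both factors of a run are runs, so the induction hypotheses apply to every way
    of splitting \<open>r\<close> between the two words.\<close>
  have "subseq r1 u \<and> subseq r2 u' \<longleftrightarrow> subseq r1 v \<and> subseq r2 v'" if "r = r1 @ r2" for r1 r2
    using append.prems append.IH by (simp add: that successively_append_iff)
  then show ?case
    by (auto simp: subseq_append_iff)
qed blast+

lemma word_eval_plac_classes:
  assumes "\<And>x. f x \<in> lists alphabet"
  shows "word_eval plac (\<lambda>x. plactic_cong `` {f x}) w = plactic_cong `` {concat (map f w)}"
proof (induction w)
  case Nil
  then show ?case
    by (simp add: word_eval_def plac_def)
next
  case (Cons x w)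
  have "concat (map f w) \<in> lists alphabet"
    using assms by (induction w) auto
  with Cons show ?case
    using plac_mult_class[of "f x" "concat (map f w)"] assms by (simp add: word_eval_def)
qed

lemma satisfies_identity_plac_cong:
  assumes "satisfies_identity plac u v" "\<And>x. f x \<in> lists alphabet"
  shows "(concat (map f u), concat (map f v)) \<in> plactic_cong"
proof -
  have "range (\<lambda>x. plactic_cong `` {f x}) \<subseteq> carrier plac"
    using assms(2) by (auto simp: plac_def quotientI)
  then have "word_eval plac (\<lambda>x. plactic_cong `` {f x}) u
      = word_eval plac (\<lambda>x. plactic_cong `` {f x}) v"
    using assms(1) by (simp add: satisfies_identity_def)
  then have "plactic_cong `` {concat (map f u)} = plactic_cong `` {concat (map f v)}"
    by (simp add: word_eval_plac_classes assms(2))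
  moreover have "concat (map f v) \<in> lists alphabet"
    using assms(2) by (induction v) auto
  ultimately show ?thesis
    by (meson eq_equiv_class equiv_plactic_cong)
qed

lemma subseq_concat_map:
  assumes "list_all2 (\<lambda>k x. k \<in> set (f x)) r w"
  shows "subseq r (concat (map f w))"
  using assms
proof (induction rule: list_all2_induct)
  case (Cons k r x w)
  then have "subseq ([k] @ r) (f x @ concat (map f w))"
    by (intro list_emb_append_mono) (simp_all add: subseq_singleton_left)
  then show ?case
    by simp
qed simp

lemma sorted_wrt_subseq:
  assumes "subseq xs ys" "sorted_wrt R ys"
  shows "sorted_wrt R xs"
  using assms by (induction rule: list_emb.induct) (auto elim: list_emb_set)

lemma sorted_wrt_less_greater_length:
  fixes xs :: "'a :: preorder list"
  assumes "sorted_wrt (<) xs" "sorted_wrt (>) xs"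
  shows "length xs \<le> 1"
  using assms by (cases xs rule: remdups_adj.cases) (auto dest: less_asym)

text \<open>An increasing block \<open>f x\<close> shares at most one letter with a descending word.
  So \<open>r\<close> takes at most one letter from each block, and if the lengths agree, exactly
  one from each, in order.\<close>

lemma descending_subseq_concat_map:
  fixes f :: "'x \<Rightarrow> 'a :: preorder list"
  assumes f: "\<And>x. sorted_wrt (<) (f x)"
    and "sorted_wrt (>) r" "subseq r (concat (map f w))"
  shows "length r \<le> length w
    \<and> (length r = length w \<longrightarrow> list_all2 (\<lambda>k x. k \<in> set (f x)) r w)"
  using assms(2,3)
proof (induction w arbitrary: r)
  case (Cons x w)
  from Cons.prems(2) obtain r1 r2
    where r: "r = r1 @ r2" and r1: "subseq r1 (f x)" and r2: "subseq r2 (concat (map f w))"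
    by (auto simp: subseq_append_iff)
  have "sorted_wrt (>) r1" "sorted_wrt (>) r2"
    using Cons.prems(1) by (simp_all add: r sorted_wrt_append)
  moreover have "sorted_wrt (<) r1"
    using f r1 sorted_wrt_subseq by blast
  ultimately have "length r1 \<le> 1"
    by (intro sorted_wrt_less_greater_length)
  moreover have IH: "length r2 \<le> length w
      \<and> (length r2 = length w \<longrightarrow> list_all2 (\<lambda>k x. k \<in> set (f x)) r2 w)"
    using Cons.IH \<open>sorted_wrt (>) r2\<close> r2 by blast
  moreover have "list_all2 (\<lambda>k x. k \<in> set (f x)) r (x # w)" if len: "length r = length (x # w)"
  proof -
    have "length r1 = 1" "length r2 = length w"
      using len IH \<open>length r1 \<le> 1\<close> by (auto simp: r)
    then obtain k where "r1 = [k]"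
      by (auto simp: length_Suc_conv)
    then show ?thesis
      using r1 IH \<open>length r2 = length w\<close> by (simp add: r subseq_singleton_left)
  qed
  ultimately show ?case
    by (auto simp: r)
qed simp

lemma satisfies_identity_plac_imp_eq:
  assumes "satisfies_identity plac u v" "length v \<le> length u"
  shows "u = v"
proof -
  define n where "n = length u"
  \<comment> \<open>Index \<open>n - k\<close> of \<open>u\<close> carries the number
    \<open>k\<close>, so numbering starts at 1, the least letter of \<open>alphabet\<close>. A
    variable that is absent from \<open>u\<close> is sent to the empty word.\<close>
  define f where "f x = filter (\<lambda>k. u ! (n - k) = x) [1..<Suc n]" for x
  define r where "r = rev [1..<Suc n]"
  have r_nth: "r ! i = n - i" if "i < n" for i
    using that by (simp add: r_def rev_nth del: upt_Suc)
  have len_r: "length r = n"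
    by (simp add: r_def)
  have run: "descending_run r"
    by (auto simp: successively_conv_nth len_r r_nth)
  have desc: "sorted_wrt (>) r"
    by (simp add: r_def sorted_wrt_rev del: upt_Suc)
  have alph: "f x \<in> lists alphabet" for x
    by (auto simp: f_def alphabet_def)
  have sorted_f: "sorted_wrt (<) (f x)" for x
    unfolding f_def by (intro sorted_wrt_filter) (simp del: upt_Suc)
  have "list_all2 (\<lambda>k x. k \<in> set (f x)) r u"
    by (auto simp: list_all2_conv_all_nth len_r r_nth f_def n_def)
  then have "subseq r (concat (map f u))"
    by (rule subseq_concat_map)
  then have "subseq r (concat (map f v))"
    using plactic_cong_subseq_descending_run[OF satisfies_identity_plac_cong[OF assms(1)]] alph run
    by blast
  then have "length r \<le> length v
      \<and> (length r = length v \<longrightarrow> list_all2 (\<lambda>k x. k \<in> set (f x)) r v)"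
    using sorted_f desc by (intro descending_subseq_concat_map)
  \<comment> \<open>The count gives \<open>n \<le> length v\<close>; the assumption on lengths gives
    the converse.\<close>
  then have "length v = n" "list_all2 (\<lambda>k x. k \<in> set (f x)) r v"
    using assms(2) by (auto simp: len_r n_def)
  \<comment> \<open>The letter \<open>n - i\<close> of \<open>r\<close> lies in
    \<open>f (v ! i)\<close>, and \<open>n - (n - i) = i\<close>.\<close>
  then have "u ! i = v ! i" if "i < n" for i
    using that by (auto simp: list_all2_conv_all_nth r_nth len_r f_def simp del: upt_Suc)
  then show ?thesis
    using \<open>length v = n\<close> by (auto intro: nth_equalityI simp: n_def)
qed

theorem theorem3p2: "\<not> (\<exists>(u :: 'x list) v. u \<noteq> v \<and> satisfies_identity plac u v)"
proof clarify
  fix u v :: "'x list"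
  assume "u \<noteq> v" and uv: "satisfies_identity plac u v"
  \<comment> \<open>By symmetry, the longer word may take the role of \<open>u\<close>.\<close>
  moreover from uv have "satisfies_identity plac v u"
    by (simp add: satisfies_identity_def)
  ultimately show False
    using satisfies_identity_plac_imp_eq nat_le_linear by metis
qed

end
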